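(* Let $n$ be an odd positive integer and let $j=2p$ be an even positive integer with $\gcd(j,n)=1$. Then $$\sum_{k=0}^{\frac{n-3}{2}} \frac{\sin\left(\frac{(j-1)(2k+1)\pi}{2n}\right)\sin\left(\frac{(j+1)(2k+1)\pi}{2n}\right)}{\sin^2\left(\frac{(2k+1)\pi}{2n}\right)\sin^2\left(\frac{j(2k+1)\pi}{2n}\right)}=\frac{n^2-1}{3}.$$
   Context: An empty sum (when $n=1$) equals $0$. *)

theory Defs
  imports Complex_Main
begin

end

theory Submission
  imports Defs
begin

text \<open>
  Since \<open>sin ((j-1)x) sin ((j+1)x) = sin\<^sup>2 (jx) - sin\<^sup>2 x\<close>, each summand is
  \<open>1/sin\<^sup>2 x - 1/sin\<^sup>2 (jx)\<close>, and both resulting sums reduce by symmetry to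
  \<open>\<Sum>r=1..<n. 1/sin\<^sup>2 (pr\<pi>/n) = (n\<^sup>2-1)/3\<close> for \<open>p\<close> coprime to \<open>n\<close>.
  For the latter, \<open>g r = \<Sum>k<n. k(n-k) cos (2pr\<pi>k/n)\<close> equals \<open>-n/(2 sin\<^sup>2 (pr\<pi>/n))\<close>
  when \<open>n\<close> does not divide \<open>r\<close>, whereas \<open>\<Sum>r<n. g r = 0\<close> because the inner cosine sums
  vanish for \<open>0 < k < n\<close>; hence the sum is \<open>2/n\<close> times \<open>g 0 = n(n\<^sup>2-1)/6\<close>.
\<close>

lemma sin_nat_mult_pi_div_eq_0_iff:
  fixes m n :: nat
  assumes "n > 0"
  shows "sin (real m * pi / real n) = 0 \<longleftrightarrow> n dvd m"
proof
  assume "sin (real m * pi / real n) = 0"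
  then obtain i :: int where "real m * pi / real n = of_int i * pi"
    by (auto simp: sin_zero_iff_int2)
  then have "real m = of_int i * real n"
    using assms by (simp add: field_simps)
  then have "int m = i * int n"
    by (metis of_int_eq_iff of_int_mult of_int_of_nat_eq)
  then show "n dvd m"
    by (metis dvd_triv_right int_dvd_int_iff)
next
  assume "n dvd m"
  then obtain c where "m = n * c" ..
  with assms show "sin (real m * pi / real n) = 0"
    by simp
qed

text \<open>Multiplying by \<open>2 * sin (x / 2)\<close> makes the sum telescope; keeping that
  factor on the left avoids a case split on \<open>sin (x / 2) = 0\<close>.\<close>

lemma sum_cos_mult:
  "2 * sin (x / 2) * (\<Sum>r<m. cos (real r * x)) = sin ((real m - 1/2) * x) + sin (x / 2)"
proof (induction m)
  case 0
  show ?case by simp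
next
  case (Suc m)
  have "2 * sin (x / 2) * cos (real m * x) = sin ((real m + 1/2) * x) - sin ((real m - 1/2) * x)"
    by (simp add: algebra_simps sin_add sin_diff)
  with Suc show ?case
    by (simp add: algebra_simps)
qed

lemma sum_cos_period_eq_0:
  fixes a n :: nat
  assumes "n > 0" "\<not> n dvd a"
  shows "(\<Sum>r<n. cos (real r * (2 * real a * pi / real n))) = 0"
proof -
  define x where "x = 2 * real a * pi / real n"
  have nz: "sin (x / 2) \<noteq> 0"
    using assms sin_nat_mult_pi_div_eq_0_iff[of n a] by (simp add: x_def)
  \<comment> \<open>Over a full period the two boundary terms of the telescoped sum cancel.\<close>
  have "(real n - 1/2) * x = 2 * real a * pi - x / 2"
    using assms by (simp add: x_def field_simps)
  then have "sin ((real n - 1/2) * x) = - sin (x / 2)"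
    using cos_2npi[of a] sin_2npi[of a] by (simp add: sin_diff)
  with sum_cos_mult[of x n] nz show ?thesis
    by (simp add: x_def)
qed

text \<open>Two summations by parts, moving the second difference from the cosine to \<open>k(n-k)\<close>.\<close>

lemma sum_quadratic_cos_mult:
  fixes c :: real
  shows "(2 - 2 * cos x) * (\<Sum>k<m. real k * (c - real k) * cos (real k * x)) =
     - real m * (c - real m) * (cos (real m * x) - cos ((real m - 1) * x))
     + (c - 2 * real m - 1) * cos (real m * x) - (c - 1) + 2 * (\<Sum>k<m. cos (real (Suc k) * x))"
proof (induction m)
  case 0
  show ?case by simp
next
  case (Suc m)
  \<comment> \<open>The three-term recurrence of the cosines eliminates the index
    \<open>m - 1\<close>, so that the induction step is a polynomial identity in
    \<open>cos x\<close>, \<open>cos (real m * x)\<close> and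
    \<open>cos (real (Suc m) * x)\<close>.\<close>
  have pm: "cos ((real m - 1) * x) = 2 * cos x * cos (real m * x) - cos (real (Suc m) * x)"
    by (simp add: algebra_simps cos_add cos_diff)
  have "real (Suc m) - 1 = real m" by simp
  with Suc pm show ?case
    by (simp only: sum.lessThan_Suc distrib_left of_nat_Suc) (simp add: algebra_simps)
qed

lemma sum_quadratic_cos_period:
  fixes a n :: nat
  assumes "n > 0" "\<not> n dvd a"
  shows "(\<Sum>k<n. real k * (real n - real k) * cos (real k * (2 * real a * pi / real n))) =
    - (real n / 2) * (1 / (sin (real a * pi / real n))\<^sup>2)"
proof -
  define x where "x = 2 * real a * pi / real n"
  have s: "sin (real a * pi / real n) \<noteq> 0"
    using assms sin_nat_mult_pi_div_eq_0_iff by blast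
  have nx: "cos (real n * x) = 1"
    using assms cos_2npi[of a] by (simp add: x_def mult.commute mult.left_commute)
  \<comment> \<open>The shifted sum also runs over one full period: the lost term at
    \<open>k = 0\<close> and the gained term at \<open>k = n\<close> are both 1.\<close>
  have "(\<Sum>k<n. cos (real (Suc k) * x)) = (\<Sum>k<Suc n. cos (real k * x)) - 1"
    by (subst sum.lessThan_Suc_shift) simp
  also have "\<dots> = 0"
    using sum_cos_period_eq_0[OF assms] nx by (simp add: x_def)
  finally have "(2 - 2 * cos x) * (\<Sum>k<n. real k * (real n - real k) * cos (real k * x)) = - 2 * real n"
    using sum_quadratic_cos_mult[where x = x and m = n and c = "real n"] nx by simp
  moreover have "2 - 2 * cos x = 4 * (sin (real a * pi / real n))\<^sup>2"
    using cos_double_sin[of "real a * pi / real n"] by (simp add: x_def mult.assoc)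
  ultimately have "4 * (sin (real a * pi / real n))\<^sup>2 *
      (\<Sum>k<n. real k * (real n - real k) * cos (real k * x)) = - 2 * real n"
    by simp
  moreover have "S = - (real n / 2) * (1 / t\<^sup>2)" if "4 * t\<^sup>2 * S = - 2 * real n" "t \<noteq> 0" for S t :: real
    using that by (simp add: field_simps)
  ultimately show ?thesis
    unfolding x_def[symmetric] using s by blast
qed

lemma sum_quadratic_lessThan:
  "(\<Sum>k<m. real k * (c - real k)) =
    c * (real m * (real m - 1) / 2) - real m * (real m - 1) * (2 * real m - 1) / 6"
  by (induction m) (simp_all add: field_simps)

theorem sum_csc_squared:
  fixes n p :: nat
  assumes "n > 0" "coprime p n"
  shows "(\<Sum>r=1..<n. 1 / (sin (real (p * r) * pi / real n))\<^sup>2) = ((real n)\<^sup>2 - 1) / 3"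
proof -
  define g where "g r = (\<Sum>k<n. real k * (real n - real k) * cos (real k * (2 * real (p * r) * pi / real n)))"
    for r
  have ndvd: "\<not> n dvd p * r" if "0 < r" "r < n" for r
    using that assms by (metis coprime_commute coprime_dvd_mult_right_iff nat_dvd_not_less)
  \<comment> \<open>The angle is symmetric in \<open>r\<close> and \<open>k\<close>, so exchanging
    the sums leaves an inner sum of pure cosines with frequency \<open>p * k\<close>. It vanishes
    for \<open>0 < k\<close>, while at \<open>k = 0\<close> the weight is zero.\<close>
  have "(\<Sum>r<n. g r) =
      (\<Sum>k<n. real k * (real n - real k) * (\<Sum>r<n. cos (real r * (2 * real (p * k) * pi / real n))))"
    unfolding g_def by (subst sum.swap) (simp add: sum_distrib_left mult_ac)
  also have "\<dots> = 0"
  proof (rule sum.neutral, safe)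
    fix k assume "k < n"
    then show "real k * (real n - real k) * (\<Sum>r<n. cos (real r * (2 * real (p * k) * pi / real n))) = 0"
      using sum_cos_period_eq_0[OF assms(1) ndvd] by (cases "k = 0") auto
  qed
  finally have "g 0 + (\<Sum>r=1..<n. g r) = 0"
    using assms(1) by (simp add: lessThan_atLeast0 sum.atLeast_Suc_lessThan)
  moreover have "g 0 = real n * ((real n)\<^sup>2 - 1) / 6"
    unfolding g_def by (simp add: sum_quadratic_lessThan) (simp add: field_simps power2_eq_square)
  moreover have "(\<Sum>r=1..<n. g r) =
      - (real n / 2) * (\<Sum>r=1..<n. 1 / (sin (real (p * r) * pi / real n))\<^sup>2)"
    unfolding sum_distrib_left g_def
    by (intro sum.cong refl sum_quadratic_cos_period[OF assms(1) ndvd]) auto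
  ultimately have "real n * (((real n)\<^sup>2 - 1) / 3 -
      (\<Sum>r=1..<n. 1 / (sin (real (p * r) * pi / real n))\<^sup>2)) = 0"
    by (simp add: field_simps)
  with assms(1) show ?thesis
    by simp
qed

text \<open>The reflection about an odd total \<open>2 * h + 1\<close> swaps even and odd indices,
  so both halves contribute equally.\<close>

lemma sum_symmetric_odd:
  fixes f :: "nat \<Rightarrow> 'a::comm_semiring_1"
  assumes "\<And>r. 0 < r \<Longrightarrow> r < 2 * h + 1 \<Longrightarrow> f (2 * h + 1 - r) = f r"
  shows "(\<Sum>r=1..<2 * h + 1. f r) = 2 * (\<Sum>k<h. f (2 * k + 1))"
proof -
  have "(\<Sum>r=1..<2 * h + 1. f r) = (\<Sum>k<h. f (2 * k + 1)) + (\<Sum>k<h. f (2 * k + 2))"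
    by (induction h) (simp_all add: algebra_simps)
  also have "(\<Sum>k<h. f (2 * k + 2)) = (\<Sum>k<h. f (2 * (h - Suc k) + 2))"
    by (rule sum.nat_diff_reindex[symmetric])
  also have "\<dots> = (\<Sum>k<h. f (2 * k + 1))"
  proof (rule sum.cong)
    fix k assume "k \<in> {..<h}"
    then have "2 * (h - Suc k) + 2 = 2 * h + 1 - (2 * k + 1)" "2 * k + 1 < 2 * h + 1"
      by auto
    then show "f (2 * (h - Suc k) + 2) = f (2 * k + 1)"
      using assms[of "2 * k + 1"] by simp
  qed simp
  finally show ?thesis
    by (simp add: mult_2)
qed

text \<open>The reflection of \<open>k\<close> to \<open>2 * h - k\<close> pairs all indices except
  the fixed point \<open>h\<close>.\<close>

lemma sum_symmetric_middle:
  fixes f :: "nat \<Rightarrow> 'a::comm_semiring_1"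
  assumes "\<And>k. k < h \<Longrightarrow> f (2 * h - k) = f k"
  shows "(\<Sum>k<2 * h + 1. f k) = f h + 2 * (\<Sum>k<h. f k)"
proof -
  have "(\<Sum>k<2 * h + 1. f k) = (\<Sum>k<h. f k) + (\<Sum>k=h..<h + Suc h. f k)"
    using sum.atLeastLessThan_concat[of 0 h "2 * h + 1" f] by (simp add: lessThan_atLeast0 mult_2)
  also have "(\<Sum>k=h..<h + Suc h. f k) = (\<Sum>k<Suc h. f (h + k))"
    using sum.shift_bounds_nat_ivl[of f 0 h "Suc h"] by (simp add: lessThan_atLeast0 add.commute)
  also have "\<dots> = f h + (\<Sum>k<h. f (h + Suc k))"
    by (subst sum.lessThan_Suc_shift) simp
  also have "(\<Sum>k<h. f (h + Suc k)) = (\<Sum>k<h. f (h + Suc (h - Suc k)))"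
    by (rule sum.nat_diff_reindex[symmetric])
  also have "\<dots> = (\<Sum>k<h. f k)"
  proof (rule sum.cong)
    fix k assume "k \<in> {..<h}"
    then have "h + Suc (h - Suc k) = 2 * h - k" "k < h"
      by auto
    then show "f (h + Suc (h - Suc k)) = f k"
      using assms[of k] by simp
  qed simp
  finally show ?thesis
    by (simp add: mult_2 algebra_simps)
qed

lemma sum_csc_squared_odd_multiples:
  fixes n p h :: nat
  assumes n: "n = 2 * h + 1" and "coprime p n"
  shows "(\<Sum>k<h. 1 / (sin (real (p * (2 * k + 1)) * pi / real n))\<^sup>2) = ((real n)\<^sup>2 - 1) / 6"
proof -
  define f where "f r = 1 / (sin (real (p * r) * pi / real n))\<^sup>2" for r
  have "f (2 * h + 1 - r) = f r" if "r < 2 * h + 1" for r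
  proof -
    \<comment> \<open>Reflection followed by a shift by \<open>p * pi\<close> changes the sine at
      most by a sign, which the square removes.\<close>
    have "real (p * (2 * h + 1 - r)) * pi / real n = real p * pi - real (p * r) * pi / real n"
      using that n by (simp add: of_nat_diff field_simps)
    then show ?thesis
      by (simp add: f_def sin_diff power_mult_distrib cos_npi sin_npi flip: power_mult)
  qed
  then have "2 * (\<Sum>k<h. f (2 * k + 1)) = (\<Sum>r=1..<n. f r)"
    using sum_symmetric_odd[of h f] n by simp
  also have "\<dots> = ((real n)\<^sup>2 - 1) / 3"
    unfolding f_def using assms by (intro sum_csc_squared) auto
  finally show ?thesis
    by (simp add: f_def)
qed

text \<open>The sum for modulus \<open>2 * n\<close> minus its even-indexed terms, which form the
  sum for modulus \<open>n\<close>, is (4n^2 - 1)/3 - (n^2 - 1)/3 = n^2. Removing the middle term 1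
  and halving by symmetry gives the value.\<close>

lemma sum_csc_squared_half_odd_multiples:
  fixes n h :: nat
  assumes n: "n = 2 * h + 1"
  shows "(\<Sum>k<h. 1 / (sin (real (2 * k + 1) * pi / (2 * real n)))\<^sup>2) = ((real n)\<^sup>2 - 1) / 2"
proof -
  define f where "f r = 1 / (sin (real r * pi / (2 * real n)))\<^sup>2" for r
  have "n > 0" using n by simp
  have split: "(\<Sum>r=1..<2 * m. f r) = (\<Sum>k<m. f (2 * k + 1)) + (\<Sum>k=1..<m. f (2 * k))"
    if "m > 0" for m
    using that by (induction m rule: nat_induct_non_zero) (simp_all add: numeral_2_eq_2 algebra_simps)
  have "(\<Sum>r=1..<2 * n. f r) = ((2 * real n)\<^sup>2 - 1) / 3"
    using sum_csc_squared[of "2 * n" 1] \<open>n > 0\<close> by (simp add: f_def)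
  moreover have "(\<Sum>k=1..<n. f (2 * k)) = ((real n)\<^sup>2 - 1) / 3"
    using sum_csc_squared[of n 1] \<open>n > 0\<close> by (simp add: f_def)
  ultimately have "(\<Sum>k<n. f (2 * k + 1)) = (real n)\<^sup>2"
    using split[OF \<open>n > 0\<close>] by (simp add: power_mult_distrib field_simps)
  moreover have "(\<Sum>k<n. f (2 * k + 1)) = f (2 * h + 1) + 2 * (\<Sum>k<h. f (2 * k + 1))"
    unfolding n
  proof (rule sum_symmetric_middle)
    fix k assume "k < h"
    then have "real (2 * (2 * h - k) + 1) * pi / (2 * real n) =
        pi - real (2 * k + 1) * pi / (2 * real n)"
      using n by (simp add: of_nat_diff field_simps)
    then show "f (2 * (2 * h - k) + 1) = f (2 * k + 1)"
      unfolding f_def by simp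
  qed
  \<comment> \<open>The middle index is \<open>n\<close> itself, where the angle is pi/2.\<close>
  moreover have "f (2 * h + 1) = 1"
    using \<open>n > 0\<close> unfolding f_def n[symmetric] by simp
  ultimately show ?thesis
    by (simp add: f_def)
qed

theorem theorem2p3:
  fixes n j p :: nat
  assumes "odd n" and "j = 2 * p" and "j > 0" and "gcd j n = 1"
  shows "(\<Sum>k<(n - 1) div 2.
            sin ((real j - 1) * (2 * real k + 1) * pi / (2 * real n)) *
            sin ((real j + 1) * (2 * real k + 1) * pi / (2 * real n)) /
            ((sin ((2 * real k + 1) * pi / (2 * real n)))\<^sup>2 *
             (sin (real j * (2 * real k + 1) * pi / (2 * real n)))\<^sup>2))
         = ((real n)\<^sup>2 - 1) / 3"
proof -
  obtain h where n: "n = 2 * h + 1"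
    using assms(1) by (elim oddE)
  then have "n > 0"
    by simp
  have cop: "coprime p n"
    using assms(2,4) by (metis coprime_iff_gcd_eq_1 coprime_mult_left_iff)
  have term_eq: "sin ((real j - 1) * (2 * real k + 1) * pi / (2 * real n)) *
      sin ((real j + 1) * (2 * real k + 1) * pi / (2 * real n)) /
      ((sin ((2 * real k + 1) * pi / (2 * real n)))\<^sup>2 *
       (sin (real j * (2 * real k + 1) * pi / (2 * real n)))\<^sup>2) =
      1 / (sin (real (2 * k + 1) * pi / (2 * real n)))\<^sup>2 -
      1 / (sin (real (p * (2 * k + 1)) * pi / real n))\<^sup>2" if "k < h" for k
  proof -
    define x where "x = real (2 * k + 1) * pi / (2 * real n)"
    define y where "y = real (p * (2 * k + 1)) * pi / real n"
    have args: "(real j - 1) * (2 * real k + 1) * pi / (2 * real n) = y - x"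
      "(real j + 1) * (2 * real k + 1) * pi / (2 * real n) = y + x"
      "(2 * real k + 1) * pi / (2 * real n) = x"
      "real j * (2 * real k + 1) * pi / (2 * real n) = y"
      using \<open>n > 0\<close> by (simp_all add: x_def y_def assms(2) field_simps)
    have "\<not> 2 * n dvd 2 * k + 1"
      using that n by (auto dest: dvd_imp_le)
    then have x0: "sin x \<noteq> 0"
      using sin_nat_mult_pi_div_eq_0_iff[of "2 * n" "2 * k + 1"] n by (simp add: x_def)
    \<comment> \<open>By coprimality \<open>n\<close> would divide \<open>2 * k + 1\<close>, but
      \<open>k < h\<close> gives \<open>0 < 2 * k + 1 < n\<close>. At \<open>k = h\<close> the
      denominator would vanish.\<close>
    have "\<not> n dvd p * (2 * k + 1)"
      using that n cop coprime_dvd_mult_right_iff[of n p "2 * k + 1"]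
      by (auto simp: coprime_commute dest: dvd_imp_le)
    then have y0: "sin y \<noteq> 0"
      using sin_nat_mult_pi_div_eq_0_iff[of n "p * (2 * k + 1)"] \<open>n > 0\<close> unfolding y_def by blast
    have "sin (y - x) * sin (y + x) = (sin y)\<^sup>2 * (cos x)\<^sup>2 - (cos y)\<^sup>2 * (sin x)\<^sup>2"
      by (simp add: sin_add sin_diff algebra_simps power2_eq_square)
    also have "\<dots> = (sin y)\<^sup>2 - (sin x)\<^sup>2"
      by (simp add: cos_squared_eq algebra_simps)
    finally show ?thesis
      unfolding args x_def[symmetric] y_def[symmetric] using x0 y0 by (simp add: field_simps)
  qed
  \<comment> \<open>It remains to subtract the two sums: (n^2 - 1)/2 - (n^2 - 1)/6 = (n^2 - 1)/3.
    The casts stay folded below so that the summands match those of the two lemmas.\<close>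
  have "(n - 1) div 2 = h"
    using n by simp
  then show ?thesis
    using sum_csc_squared_half_odd_multiples[OF n] sum_csc_squared_odd_multiples[OF n cop]
    by (simp add: term_eq sum_subtractf del: of_nat_mult of_nat_add)
qed

end
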